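(* Let $I\subseteq[0,\infty)$, $\Theta\subseteq(0,\infty)$, $A$, $\mathcal V$, $\mathcal W$, $T$ and $m_\theta$ be as in the context. Let $f\in\mathcal V$, let $(f_n)_{n\in\mathbb N}$ be a sequence in $\mathcal V$, and let $\theta\in\Theta$ be admissible for $f$ and for every $f_n$. (i) If either [$T(f_n)$ is decreasing on $I$ for all $n\in\mathbb N$, and $A(\cdot,\theta)$ is increasing on $I$], or [$T(f_n)$ is increasing on $I$ for all $n\in\mathbb N$, and $A(\cdot,\theta)$ is decreasing on $I$], then for all $n\in\mathbb N$ $$\left|A(m_\theta(f_n),\theta)-A(m_\theta(f),\theta)\right|\le\left|T(f_n)(m_\theta(f))-T(f)(m_\theta(f))\right|.$$ (ii) If either [$T(f_n)$ is increasing on $I$ and $T(f_n)(\cdot)-A(\cdot,\theta)$ is decreasing on $I$, for all $n\in\mathbb N$], or [$T(f_n)$ is decreasing on $I$ and $T(f_n)(\cdot)-A(\cdot,\theta)$ is increasing on $I$, for all $n\in\mathbb N$], then for all $n\in\mathbb N$ $$\left|T(f_n)(m_\theta(f))-T(f)(m_\theta(f))\right|\le\left|A(m_\theta(f_n),\theta)-A(m_\theta(f),\theta)\right|.$$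
   Context: Setting. $I\subseteq[0,\infty)$ and $\Theta\subseteq(0,\infty)$ are intervals. $A:I\times\Theta\to[0,\infty)$, $(x,\theta)\mapsto A(x,\theta)$, is continuous and injective in each variable separately. $\mathcal V$ and $\mathcal W$ are sets of functions $I\to[0,\infty)$, and $T:\mathcal V\to\mathcal W$ is an operator such that $T(f)=\mathbf 0\Leftrightarrow f=\mathbf 0$, where $\mathbf 0$ is the null function. "Positive" means taking values in $[0,\infty)$. Admissibility and the Hirsch-type bundle. For $f\in\mathcal V$, a value $\theta\in\Theta$ is admissible for $f$ if the equation $T(f)(x)=A(x,\theta)$ has a unique solution $x\in I$; this solution is denoted $m_\theta(f)$. Thus, for admissible $\theta$ and $x\in I$: $x=m_\theta(f)\Leftrightarrow T(f)(x)=A(x,\theta)$. "Increasing" and "decreasing" are meant in the non-strict sense. *)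

theory Defs
  imports "HOL-Analysis.Analysis" "HOL-Library.FuncSet"
begin

(* Functions I -> [0,oo) are the elements of I \<rightarrow>\<^sub>E {0..}: their value outside I is the fixed
   dummy undefined, so that equality of such functions is equality on I. *)

definition null_fun :: "real set \<Rightarrow> real \<Rightarrow> real" where
  "null_fun I = (\<lambda>x\<in>I. 0)"

definition admissible ::
  "real set \<Rightarrow> real set \<Rightarrow> (real \<Rightarrow> real \<Rightarrow> real) \<Rightarrow> ((real \<Rightarrow> real) \<Rightarrow> real \<Rightarrow> real)
    \<Rightarrow> real \<Rightarrow> (real \<Rightarrow> real) \<Rightarrow> bool" where
  "admissible I \<Theta> A T \<theta> f \<longleftrightarrow> \<theta> \<in> \<Theta> \<and> (\<exists>!x. x \<in> I \<and> T f x = A x \<theta>)"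

definition hirsch_bundle ::
  "real set \<Rightarrow> (real \<Rightarrow> real \<Rightarrow> real) \<Rightarrow> ((real \<Rightarrow> real) \<Rightarrow> real \<Rightarrow> real)
    \<Rightarrow> real \<Rightarrow> (real \<Rightarrow> real) \<Rightarrow> real" where
  "hirsch_bundle I A T \<theta> f = (THE x. x \<in> I \<and> T f x = A x \<theta>)"

end

theory Submission imports Defs begin

text \<open>Put $p = m_\theta(f)$ and $q = m_\theta(f_n)$. Since $T(f)(p) = A(p,\theta)$ and
  $T(f_n)(q) = A(q,\theta)$, both parts only compare the three numbers $A(p,\theta)$,
  $T(f_n)(p)$ and $T(f_n)(q) = A(q,\theta)$. In part (i) monotonicity puts $A(q,\theta)$ between
  $A(p,\theta)$ and $T(f_n)(p)$; in part (ii) it puts $T(f_n)(p)$ between $A(p,\theta)$ and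
  $A(q,\theta)$.\<close>

lemma hirsch_bundle_solution:
  assumes "admissible I \<Theta> A T \<theta> f"
  shows "hirsch_bundle I A T \<theta> f \<in> I"
    and "T f (hirsch_bundle I A T \<theta> f) = A (hirsch_bundle I A T \<theta> f) \<theta>"
  using theI'[of "\<lambda>x. x \<in> I \<and> T f x = A x \<theta>"] assms
  unfolding admissible_def hirsch_bundle_def by auto

text \<open>Here \<open>q\<close> is a point where \<open>g\<close> and \<open>a\<close> meet. For
  \<open>g\<close> decreasing and \<open>a\<close> increasing, \<open>p \<le> q\<close> gives
  \<open>a p \<le> a q = g q \<le> g p\<close>, and \<open>q \<le> p\<close> reverses the chain.
  Swapping the two monotonicities is symmetric.\<close>

lemma crossing_value_diff_le:
  fixes g a :: "'a::linorder \<Rightarrow> 'b::linordered_idom"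
  assumes "antimono_on I g \<and> mono_on I a \<or> mono_on I g \<and> antimono_on I a"
    and "p \<in> I" "q \<in> I" "g q = a q"
  shows "\<bar>a q - a p\<bar> \<le> \<bar>g p - a p\<bar>"
  using linear[of p q] assms
  by (elim disjE conjE; fastforce dest: monotone_onD[of _ _ _ _ p q] monotone_onD[of _ _ _ _ q p])

text \<open>The difference \<open>g - a\<close> vanishes at \<open>q\<close>, so its monotonicity
  fixes the sign of \<open>g p - a p\<close>, while that of \<open>g\<close> compares
  \<open>g p\<close> with \<open>g q = a q\<close>. For \<open>g\<close> increasing,
  \<open>g - a\<close> decreasing and \<open>p \<le> q\<close>, this reads
  \<open>a p \<le> g p \<le> a q\<close>.\<close>

lemma crossing_value_diff_ge:
  fixes g a :: "'a::linorder \<Rightarrow> 'b::linordered_idom"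
  assumes "mono_on I g \<and> antimono_on I (\<lambda>x. g x - a x)
      \<or> antimono_on I g \<and> mono_on I (\<lambda>x. g x - a x)"
    and "p \<in> I" "q \<in> I" "g q = a q"
  shows "\<bar>g p - a p\<bar> \<le> \<bar>a q - a p\<bar>"
  using linear[of p q] assms
  by (elim disjE conjE; fastforce dest: monotone_onD[of _ _ _ _ p q] monotone_onD[of _ _ _ _ q p])

theorem mainTheorem1:
  fixes I \<Theta> :: "real set"
    and A :: "real \<Rightarrow> real \<Rightarrow> real"
    and V W :: "(real \<Rightarrow> real) set"
    and T :: "(real \<Rightarrow> real) \<Rightarrow> real \<Rightarrow> real"
    and f :: "real \<Rightarrow> real"
    and fs :: "nat \<Rightarrow> real \<Rightarrow> real"
    and \<theta> :: real
    and m :: "real \<Rightarrow> (real \<Rightarrow> real) \<Rightarrow> real"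
  defines "m \<equiv> hirsch_bundle I A T"
  assumes "is_interval I" and "I \<subseteq> {0..}"
    and "is_interval \<Theta>" and "\<Theta> \<subseteq> {0<..}"
    and "\<And>x t. x \<in> I \<Longrightarrow> t \<in> \<Theta> \<Longrightarrow> A x t \<ge> 0"
    and "\<And>t. t \<in> \<Theta> \<Longrightarrow> continuous_on I (\<lambda>x. A x t)"
    and "\<And>x. x \<in> I \<Longrightarrow> continuous_on \<Theta> (\<lambda>t. A x t)"
    and "\<And>t. t \<in> \<Theta> \<Longrightarrow> inj_on (\<lambda>x. A x t) I"
    and "\<And>x. x \<in> I \<Longrightarrow> inj_on (\<lambda>t. A x t) \<Theta>"
    and "V \<subseteq> I \<rightarrow>\<^sub>E {0..}" and "W \<subseteq> I \<rightarrow>\<^sub>E {0..}"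
    and "T \<in> V \<rightarrow> W"
    and "\<And>g. g \<in> V \<Longrightarrow> T g = null_fun I \<longleftrightarrow> g = null_fun I"
    and "f \<in> V" and "\<And>n. fs n \<in> V"
    and "admissible I \<Theta> A T \<theta> f" and "\<And>n. admissible I \<Theta> A T \<theta> (fs n)"
  shows "(((\<forall>n. antimono_on I (T (fs n))) \<and> mono_on I (\<lambda>x. A x \<theta>)
           \<or> (\<forall>n. mono_on I (T (fs n))) \<and> antimono_on I (\<lambda>x. A x \<theta>))
          \<longrightarrow> (\<forall>n. \<bar>A (m \<theta> (fs n)) \<theta> - A (m \<theta> f) \<theta>\<bar>
                    \<le> \<bar>T (fs n) (m \<theta> f) - T f (m \<theta> f)\<bar>))
       \<and> (((\<forall>n. mono_on I (T (fs n)) \<and> antimono_on I (\<lambda>x. T (fs n) x - A x \<theta>))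
           \<or> (\<forall>n. antimono_on I (T (fs n)) \<and> mono_on I (\<lambda>x. T (fs n) x - A x \<theta>)))
          \<longrightarrow> (\<forall>n. \<bar>T (fs n) (m \<theta> f) - T f (m \<theta> f)\<bar>
                    \<le> \<bar>A (m \<theta> (fs n)) \<theta> - A (m \<theta> f) \<theta>\<bar>))"
proof -
  have "m \<theta> f \<in> I" "T f (m \<theta> f) = A (m \<theta> f) \<theta>"
    unfolding m_def using hirsch_bundle_solution assms(17) by blast+
  moreover have "m \<theta> (fs n) \<in> I" "T (fs n) (m \<theta> (fs n)) = A (m \<theta> (fs n)) \<theta>" for n
    unfolding m_def using hirsch_bundle_solution assms(18) by blast+
  \<comment> \<open>Both lemmas apply with \<open>g = T (fs n)\<close>,
    \<open>p = m \<theta> f\<close> and \<open>q = m \<theta> (fs n)\<close>: the equation for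
    \<open>f\<close> replaces \<open>T f p\<close> by \<open>A p \<theta>\<close>, and the one for
    \<open>fs n\<close> is the crossing condition \<open>g q = a q\<close>. Naming \<open>a\<close>
    settles an otherwise ambiguous higher-order match.\<close>
  ultimately show ?thesis
    by (auto intro!: crossing_value_diff_le[where a = "\<lambda>x. A x \<theta>"]
        crossing_value_diff_ge[where a = "\<lambda>x. A x \<theta>"])
qed

end
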